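(* Let $\mathcal{B}$ be a rigid braided category, considered as a module category over itself under left multiplication. Then braided structures on this $\mathcal{B}$-module are in bijective correspondence with anti-twists, i.e., with $\varsigma\in Aut(Id_{\mathcal{B}})$ satisfying $$\varsigma_{X\otimes Y}=\tau^{-2}_{X,Y}(\varsigma_X\otimes\varsigma_Y)\quad\text{for all }X,Y\in\mathcal{B}.$$
   Context: $\tau$ is the braiding of $\mathcal{B}$; $\tau^2_{X,Y}=\tau_{Y,X}\tau_{X,Y}$, $\tau^{-2}_{X,Y}=(\tau^2_{X,Y})^{-1}$, and $\tau^{-1}_{X,Y}:=(\tau_{Y,X})^{-1}:X\otimes Y\to Y\otimes X$. A braided structure on a left $\mathcal{B}$-module category $\mathcal{M}$ is a natural automorphism $E_{X,M}:X\cdot M\to X\cdot M$ of the action functor $\mathcal{B}\times\mathcal{M}\to\mathcal{M}$ satisfying (with identity factors suppressed) $E_{Y,X\cdot M}=\tau^{-1}_{X,Y}E_{Y,M}\tau^{-1}_{Y,X}$ and $E_{Y\otimes X,M}=E_{Y,X\cdot M}E_{X,M}$. *)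

theory Defs
  imports "HOL-Library.FuncSet"
begin

section \<open>Categories\<close>

record ('o, 'a) category =
  Obj :: "'o set"
  Arr :: "'a set"
  Dom :: "'a \<Rightarrow> 'o"
  Cod :: "'a \<Rightarrow> 'o"
  Ident :: "'o \<Rightarrow> 'a"  (\<open>\<one>\<index>\<close>)
  Comp :: "'a \<Rightarrow> 'a \<Rightarrow> 'a"  (infixr \<open>\<cdot>\<index>\<close> 55)

definition Hom :: "('o, 'a, 'z) category_scheme \<Rightarrow> 'o \<Rightarrow> 'o \<Rightarrow> 'a set" where
  "Hom C X Y = {f \<in> Arr C. Dom C f = X \<and> Cod C f = Y}"

text \<open>Composition is written in the applicative order: \<open>g \<cdot> f\<close> means \<open>f\<close> first.\<close>

locale category =
  fixes C :: "('o, 'a, 'z) category_scheme" (structure)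
  assumes dom_closed: "f \<in> Arr C \<Longrightarrow> Dom C f \<in> Obj C"
    and cod_closed: "f \<in> Arr C \<Longrightarrow> Cod C f \<in> Obj C"
    and ident_closed: "X \<in> Obj C \<Longrightarrow> \<one> X \<in> Hom C X X"
    and comp_closed: "f \<in> Hom C X Y \<Longrightarrow> g \<in> Hom C Y Z \<Longrightarrow> g \<cdot> f \<in> Hom C X Z"
    and comp_assoc:
      "f \<in> Hom C W X \<Longrightarrow> g \<in> Hom C X Y \<Longrightarrow> h \<in> Hom C Y Z \<Longrightarrow> (h \<cdot> g) \<cdot> f = h \<cdot> (g \<cdot> f)"
    and comp_ident_left: "f \<in> Hom C X Y \<Longrightarrow> \<one> Y \<cdot> f = f"
    and comp_ident_right: "f \<in> Hom C X Y \<Longrightarrow> f \<cdot> \<one> X = f"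

definition inverse_arrows :: "('o, 'a, 'z) category_scheme \<Rightarrow> 'a \<Rightarrow> 'a \<Rightarrow> bool" where
  "inverse_arrows C f g \<longleftrightarrow>
     f \<in> Arr C \<and> g \<in> Hom C (Cod C f) (Dom C f) \<and>
     g \<cdot>\<^bsub>C\<^esub> f = \<one>\<^bsub>C\<^esub> (Dom C f) \<and> f \<cdot>\<^bsub>C\<^esub> g = \<one>\<^bsub>C\<^esub> (Cod C f)"

definition is_iso :: "('o, 'a, 'z) category_scheme \<Rightarrow> 'a \<Rightarrow> bool" where
  "is_iso C f \<longleftrightarrow> (\<exists>g. inverse_arrows C f g)"

definition arr_inv :: "('o, 'a, 'z) category_scheme \<Rightarrow> 'a \<Rightarrow> 'a"  (\<open>inv\<index> _\<close> [81] 80) where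
  "arr_inv C f = (THE g. inverse_arrows C f g)"

definition prod_category ::
  "('o, 'a, 'y) category_scheme \<Rightarrow> ('p, 'b, 'z) category_scheme \<Rightarrow> ('o \<times> 'p, 'a \<times> 'b) category"
  (infixr \<open>\<times>\<^sub>c\<close> 70) where
  "C \<times>\<^sub>c D =
    \<lparr> Obj = Obj C \<times> Obj D,
      Arr = Arr C \<times> Arr D,
      Dom = (\<lambda>(f, g). (Dom C f, Dom D g)),
      Cod = (\<lambda>(f, g). (Cod C f, Cod D g)),
      Ident = (\<lambda>(X, Y). (\<one>\<^bsub>C\<^esub> X, \<one>\<^bsub>D\<^esub> Y)),
      Comp = (\<lambda>(f', g') (f, g). (f' \<cdot>\<^bsub>C\<^esub> f, g' \<cdot>\<^bsub>D\<^esub> g)) \<rparr>"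

record ('o, 'a, 'p, 'b) cat_functor =
  on_obj :: "'o \<Rightarrow> 'p"
  on_arr :: "'a \<Rightarrow> 'b"

definition is_functor ::
  "('o, 'a, 'y) category_scheme \<Rightarrow> ('p, 'b, 'z) category_scheme
     \<Rightarrow> ('o, 'a, 'p, 'b) cat_functor \<Rightarrow> bool" where
  "is_functor C D F \<longleftrightarrow>
     (\<forall>X \<in> Obj C. on_obj F X \<in> Obj D) \<and>
     (\<forall>f \<in> Arr C. on_arr F f \<in> Hom D (on_obj F (Dom C f)) (on_obj F (Cod C f))) \<and>
     (\<forall>X \<in> Obj C. on_arr F (\<one>\<^bsub>C\<^esub> X) = \<one>\<^bsub>D\<^esub> (on_obj F X)) \<and>
     (\<forall>f \<in> Arr C. \<forall>g \<in> Arr C. Cod C f = Dom C g \<longrightarrow>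
        on_arr F (g \<cdot>\<^bsub>C\<^esub> f) = on_arr F g \<cdot>\<^bsub>D\<^esub> on_arr F f)"

definition natural_iso ::
  "('o, 'a, 'y) category_scheme \<Rightarrow> ('p, 'b, 'z) category_scheme
     \<Rightarrow> ('o, 'a, 'p, 'b) cat_functor \<Rightarrow> ('o, 'a, 'p, 'b) cat_functor
     \<Rightarrow> ('o \<Rightarrow> 'b) \<Rightarrow> bool" where
  "natural_iso C D F G \<eta> \<longleftrightarrow>
     (\<forall>X \<in> Obj C. \<eta> X \<in> Hom D (on_obj F X) (on_obj G X) \<and> is_iso D (\<eta> X)) \<and>
     (\<forall>f \<in> Arr C. \<eta> (Cod C f) \<cdot>\<^bsub>D\<^esub> on_arr F f = on_arr G f \<cdot>\<^bsub>D\<^esub> \<eta> (Dom C f))"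

text \<open>
  A natural automorphism is a family indexed by \<open>Obj C\<close>, represented by a function that is
  \<open>undefined\<close> outside \<open>Obj C\<close>, so that equal families are equal functions.
\<close>

definition natural_automorphisms ::
  "('o, 'a, 'y) category_scheme \<Rightarrow> ('p, 'b, 'z) category_scheme
     \<Rightarrow> ('o, 'a, 'p, 'b) cat_functor \<Rightarrow> ('o \<Rightarrow> 'b) set" where
  "natural_automorphisms C D F = {\<eta> \<in> extensional (Obj C). natural_iso C D F F \<eta>}"

definition id_functor :: "('o, 'a, 'o, 'a) cat_functor" where
  "id_functor = \<lparr> on_obj = (\<lambda>X. X), on_arr = (\<lambda>f. f) \<rparr>"


section \<open>Monoidal, braided and rigid categories\<close>

record ('o, 'a) monoidal_category = "('o, 'a) category" +
  tensor :: "('o \<times> 'o, 'a \<times> 'a, 'o, 'a) cat_functor"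
  unit_obj :: "'o"  (\<open>\<I>\<index>\<close>)
  associator :: "'o \<times> 'o \<times> 'o \<Rightarrow> 'a"
  left_unitor :: "'o \<Rightarrow> 'a"
  right_unitor :: "'o \<Rightarrow> 'a"

abbreviation tensor_obj ::
  "('o, 'a, 'z) monoidal_category_scheme \<Rightarrow> 'o \<Rightarrow> 'o \<Rightarrow> 'o"  (infixr \<open>\<otimes>\<index>\<close> 65) where
  "X \<otimes>\<^bsub>B\<^esub> Y \<equiv> on_obj (tensor B) (X, Y)"

abbreviation tensor_arr ::
  "('o, 'a, 'z) monoidal_category_scheme \<Rightarrow> 'a \<Rightarrow> 'a \<Rightarrow> 'a"  (infixr \<open>\<odot>\<index>\<close> 65) where
  "f \<odot>\<^bsub>B\<^esub> g \<equiv> on_arr (tensor B) (f, g)"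

text \<open>
  \<open>associator (X, Y, Z) : (X \<otimes> Y) \<otimes> Z \<rightarrow> X \<otimes> (Y \<otimes> Z)\<close>,
  \<open>left_unitor X : \<I> \<otimes> X \<rightarrow> X\<close>, \<open>right_unitor X : X \<otimes> \<I> \<rightarrow> X\<close>.
\<close>

locale monoidal_category = category B
  for B :: "('o, 'a, 'z) monoidal_category_scheme" (structure) +
  assumes tensor_functor: "is_functor (B \<times>\<^sub>c B) B (tensor B)"
    and unit_closed: "\<I> \<in> Obj B"
    and associator_natural:
      "natural_iso (B \<times>\<^sub>c B \<times>\<^sub>c B) B
         \<lparr> on_obj = (\<lambda>(X, Y, Z). (X \<otimes> Y) \<otimes> Z), on_arr = (\<lambda>(f, g, h). (f \<odot> g) \<odot> h) \<rparr>
         \<lparr> on_obj = (\<lambda>(X, Y, Z). X \<otimes> (Y \<otimes> Z)), on_arr = (\<lambda>(f, g, h). f \<odot> (g \<odot> h)) \<rparr>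
         (associator B)"
    and left_unitor_natural:
      "natural_iso B B \<lparr> on_obj = (\<lambda>X. \<I> \<otimes> X), on_arr = (\<lambda>f. \<one> \<I> \<odot> f) \<rparr> id_functor
         (left_unitor B)"
    and right_unitor_natural:
      "natural_iso B B \<lparr> on_obj = (\<lambda>X. X \<otimes> \<I>), on_arr = (\<lambda>f. f \<odot> \<one> \<I>) \<rparr> id_functor
         (right_unitor B)"
    and pentagon:
      "\<lbrakk>W \<in> Obj B; X \<in> Obj B; Y \<in> Obj B; Z \<in> Obj B\<rbrakk> \<Longrightarrow>
         associator B (W, X, Y \<otimes> Z) \<cdot> associator B (W \<otimes> X, Y, Z) =
         (\<one> W \<odot> associator B (X, Y, Z)) \<cdot> associator B (W, X \<otimes> Y, Z) \<cdot>
           (associator B (W, X, Y) \<odot> \<one> Z)"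
    and triangle:
      "\<lbrakk>X \<in> Obj B; Y \<in> Obj B\<rbrakk> \<Longrightarrow>
         (\<one> X \<odot> left_unitor B Y) \<cdot> associator B (X, \<I>, Y) = right_unitor B X \<odot> \<one> Y"

record ('o, 'a) braided_category = "('o, 'a) monoidal_category" +
  braiding :: "'o \<times> 'o \<Rightarrow> 'a"

locale braided_category = monoidal_category B
  for B :: "('o, 'a, 'z) braided_category_scheme" (structure) +
  assumes braiding_natural:
      "natural_iso (B \<times>\<^sub>c B) B (tensor B)
         \<lparr> on_obj = (\<lambda>(X, Y). Y \<otimes> X), on_arr = (\<lambda>(f, g). g \<odot> f) \<rparr> (braiding B)"
    and hexagon:
      "\<lbrakk>X \<in> Obj B; Y \<in> Obj B; Z \<in> Obj B\<rbrakk> \<Longrightarrow>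
         associator B (Y, Z, X) \<cdot> braiding B (X, Y \<otimes> Z) \<cdot> associator B (X, Y, Z) =
         (\<one> Y \<odot> braiding B (X, Z)) \<cdot> associator B (Y, X, Z) \<cdot> (braiding B (X, Y) \<odot> \<one> Z)"
    and hexagon':
      "\<lbrakk>X \<in> Obj B; Y \<in> Obj B; Z \<in> Obj B\<rbrakk> \<Longrightarrow>
         inv (associator B (Z, X, Y)) \<cdot> braiding B (X \<otimes> Y, Z) \<cdot> inv (associator B (X, Y, Z)) =
         (braiding B (X, Z) \<odot> \<one> Y) \<cdot> inv (associator B (X, Z, Y)) \<cdot> (\<one> X \<odot> braiding B (Y, Z))"

text \<open>\<open>X'\<close> is a left dual of \<open>X\<close>; equivalently, \<open>X\<close> is a right dual of \<open>X'\<close>.\<close>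

definition dual_objects ::
  "('o, 'a, 'z) monoidal_category_scheme \<Rightarrow> 'o \<Rightarrow> 'o \<Rightarrow> bool" where
  "dual_objects B X' X \<longleftrightarrow>
     (\<exists>ev coev.
        ev \<in> Hom B (X' \<otimes>\<^bsub>B\<^esub> X) \<I>\<^bsub>B\<^esub> \<and>
        coev \<in> Hom B \<I>\<^bsub>B\<^esub> (X \<otimes>\<^bsub>B\<^esub> X') \<and>
        right_unitor B X \<cdot>\<^bsub>B\<^esub> (\<one>\<^bsub>B\<^esub> X \<odot>\<^bsub>B\<^esub> ev) \<cdot>\<^bsub>B\<^esub> associator B (X, X', X) \<cdot>\<^bsub>B\<^esub>
          (coev \<odot>\<^bsub>B\<^esub> \<one>\<^bsub>B\<^esub> X) \<cdot>\<^bsub>B\<^esub> inv\<^bsub>B\<^esub> (left_unitor B X) = \<one>\<^bsub>B\<^esub> X \<and>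
        left_unitor B X' \<cdot>\<^bsub>B\<^esub> (ev \<odot>\<^bsub>B\<^esub> \<one>\<^bsub>B\<^esub> X') \<cdot>\<^bsub>B\<^esub> inv\<^bsub>B\<^esub> (associator B (X', X, X')) \<cdot>\<^bsub>B\<^esub>
          (\<one>\<^bsub>B\<^esub> X' \<odot>\<^bsub>B\<^esub> coev) \<cdot>\<^bsub>B\<^esub> inv\<^bsub>B\<^esub> (right_unitor B X') = \<one>\<^bsub>B\<^esub> X')"

locale rigid_braided_category = braided_category B
  for B :: "('o, 'a, 'z) braided_category_scheme" (structure) +
  assumes left_dual_exists: "X \<in> Obj B \<Longrightarrow> \<exists>X' \<in> Obj B. dual_objects B X' X"
    and right_dual_exists: "X \<in> Obj B \<Longrightarrow> \<exists>X' \<in> Obj B. dual_objects B X X'"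

text \<open>\<open>\<tau>\<^sup>-\<^sup>1\<^sub>X\<^sub>,\<^sub>Y = (\<tau>\<^sub>Y\<^sub>,\<^sub>X)\<^sup>-\<^sup>1 : X \<otimes> Y \<rightarrow> Y \<otimes> X\<close>; note the swap of the indices.\<close>

definition inv_braiding :: "('o, 'a, 'z) braided_category_scheme \<Rightarrow> 'o \<times> 'o \<Rightarrow> 'a" where
  "inv_braiding B = (\<lambda>(X, Y). inv\<^bsub>B\<^esub> (braiding B (Y, X)))"

definition double_braiding :: "('o, 'a, 'z) braided_category_scheme \<Rightarrow> 'o \<times> 'o \<Rightarrow> 'a" where
  "double_braiding B = (\<lambda>(X, Y). braiding B (Y, X) \<cdot>\<^bsub>B\<^esub> braiding B (X, Y))"


section \<open>Module categories and braided structures\<close>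

record ('o, 'a, 'p, 'b) module_category = "('p, 'b) category" +
  action :: "('o \<times> 'p, 'a \<times> 'b, 'p, 'b) cat_functor"
  mod_associator :: "'o \<times> 'o \<times> 'p \<Rightarrow> 'b"
  mod_unitor :: "'p \<Rightarrow> 'b"

abbreviation action_obj ::
  "('o, 'a, 'p, 'b, 'z) module_category_scheme \<Rightarrow> 'o \<Rightarrow> 'p \<Rightarrow> 'p"  (infixr \<open>\<rhd>\<index>\<close> 65) where
  "X \<rhd>\<^bsub>M\<^esub> N \<equiv> on_obj (action M) (X, N)"

abbreviation action_arr ::
  "('o, 'a, 'p, 'b, 'z) module_category_scheme \<Rightarrow> 'a \<Rightarrow> 'b \<Rightarrow> 'b"  (infixr \<open>\<diamondop>\<index>\<close> 65) where
  "f \<diamondop>\<^bsub>M\<^esub> g \<equiv> on_arr (action M) (f, g)"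

text \<open>
  \<open>mod_associator (X, Y, N) : (X \<otimes> Y) \<rhd> N \<rightarrow> X \<rhd> (Y \<rhd> N)\<close> and
  \<open>mod_unitor N : \<I> \<rhd> N \<rightarrow> N\<close>.
\<close>

locale module_category = monoidal_category B + M: category M
  for B :: "('o, 'a, 'y) monoidal_category_scheme" (structure)
    and M :: "('o, 'a, 'p, 'b, 'z) module_category_scheme" +
  assumes action_functor: "is_functor (B \<times>\<^sub>c M) M (action M)"
    and mod_associator_natural:
      "natural_iso (B \<times>\<^sub>c B \<times>\<^sub>c M) M
         \<lparr> on_obj = (\<lambda>(X, Y, N). (X \<otimes> Y) \<rhd>\<^bsub>M\<^esub> N),
           on_arr = (\<lambda>(f, g, h). (f \<odot> g) \<diamondop>\<^bsub>M\<^esub> h) \<rparr>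
         \<lparr> on_obj = (\<lambda>(X, Y, N). X \<rhd>\<^bsub>M\<^esub> (Y \<rhd>\<^bsub>M\<^esub> N)),
           on_arr = (\<lambda>(f, g, h). f \<diamondop>\<^bsub>M\<^esub> (g \<diamondop>\<^bsub>M\<^esub> h)) \<rparr>
         (mod_associator M)"
    and mod_unitor_natural:
      "natural_iso M M \<lparr> on_obj = (\<lambda>N. \<I> \<rhd>\<^bsub>M\<^esub> N), on_arr = (\<lambda>f. \<one> \<I> \<diamondop>\<^bsub>M\<^esub> f) \<rparr> id_functor
         (mod_unitor M)"
    and mod_pentagon:
      "\<lbrakk>X \<in> Obj B; Y \<in> Obj B; Z \<in> Obj B; N \<in> Obj M\<rbrakk> \<Longrightarrow>
         mod_associator M (X, Y, Z \<rhd>\<^bsub>M\<^esub> N) \<cdot>\<^bsub>M\<^esub> mod_associator M (X \<otimes> Y, Z, N) =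
         (\<one> X \<diamondop>\<^bsub>M\<^esub> mod_associator M (Y, Z, N)) \<cdot>\<^bsub>M\<^esub> mod_associator M (X, Y \<otimes> Z, N) \<cdot>\<^bsub>M\<^esub>
           (associator B (X, Y, Z) \<diamondop>\<^bsub>M\<^esub> \<one>\<^bsub>M\<^esub> N)"
    and mod_triangle:
      "\<lbrakk>X \<in> Obj B; N \<in> Obj M\<rbrakk> \<Longrightarrow>
         (\<one> X \<diamondop>\<^bsub>M\<^esub> mod_unitor M N) \<cdot>\<^bsub>M\<^esub> mod_associator M (X, \<I>, N) =
         right_unitor B X \<diamondop>\<^bsub>M\<^esub> \<one>\<^bsub>M\<^esub> N"

definition regular_module ::
  "('o, 'a, 'z) monoidal_category_scheme \<Rightarrow> ('o, 'a, 'o, 'a) module_category" where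
  "regular_module B =
    \<lparr> Obj = Obj B, Arr = Arr B, Dom = Dom B, Cod = Cod B, Ident = Ident B, Comp = Comp B,
      action = tensor B, mod_associator = associator B, mod_unitor = left_unitor B \<rparr>"

lemma regular_module_simps [simp]:
  "Obj (regular_module B) = Obj B"
  "Arr (regular_module B) = Arr B"
  "Dom (regular_module B) = Dom B"
  "Cod (regular_module B) = Cod B"
  "Ident (regular_module B) = Ident B"
  "Comp (regular_module B) = Comp B"
  "action (regular_module B) = tensor B"
  "mod_associator (regular_module B) = associator B"
  "mod_unitor (regular_module B) = left_unitor B"
  "Hom (regular_module B) = Hom B"
  "is_iso (regular_module B) = is_iso B"
  "arr_inv (regular_module B) = arr_inv B"
  "C \<times>\<^sub>c regular_module B = C \<times>\<^sub>c B"
  "natural_iso C (regular_module B) = natural_iso C B"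
  "natural_iso (regular_module B) D = natural_iso B D"
  "is_functor C (regular_module B) = is_functor C B"
  by (simp_all add: regular_module_def Hom_def is_iso_def arr_inv_def inverse_arrows_def
      prod_category_def natural_iso_def is_functor_def fun_eq_iff)

lemma (in monoidal_category) regular_module: "module_category B (regular_module B)"
proof -
  have "category (regular_module B)"
    by unfold_locales
      (auto intro: dom_closed cod_closed ident_closed comp_closed
        simp: comp_assoc comp_ident_left comp_ident_right)
  then show ?thesis
    unfolding module_category_def module_category_axioms_def
    using monoidal_category_axioms tensor_functor associator_natural left_unitor_natural
      pentagon triangle by simp
qed

text \<open>
  The two axioms of a braided structure, usually written with identities and associativity
  isomorphisms suppressed as
  \<open>E(Y, X \<rhd> N) = \<tau>\<^sup>-\<^sup>1(X, Y) \<cdot> E(Y, N) \<cdot> \<tau>\<^sup>-\<^sup>1(Y, X)\<close> and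
  \<open>E(Y \<otimes> X, N) = E(Y, X \<rhd> N) \<cdot> E(X, N)\<close>.
\<close>

definition braided_structures ::
  "('o, 'a, 'y) braided_category_scheme \<Rightarrow> ('o, 'a, 'p, 'b, 'z) module_category_scheme
     \<Rightarrow> ('o \<times> 'p \<Rightarrow> 'b) set" where
  "braided_structures B M =
    {E \<in> natural_automorphisms (B \<times>\<^sub>c M) M (action M).
      (\<forall>X \<in> Obj B. \<forall>Y \<in> Obj B. \<forall>N \<in> Obj M.
         E (Y, X \<rhd>\<^bsub>M\<^esub> N) =
           mod_associator M (Y, X, N) \<cdot>\<^bsub>M\<^esub>
           (inv_braiding B (X, Y) \<diamondop>\<^bsub>M\<^esub> \<one>\<^bsub>M\<^esub> N) \<cdot>\<^bsub>M\<^esub>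
           inv\<^bsub>M\<^esub> (mod_associator M (X, Y, N)) \<cdot>\<^bsub>M\<^esub>
           (\<one>\<^bsub>B\<^esub> X \<diamondop>\<^bsub>M\<^esub> E (Y, N)) \<cdot>\<^bsub>M\<^esub>
           mod_associator M (X, Y, N) \<cdot>\<^bsub>M\<^esub>
           (inv_braiding B (Y, X) \<diamondop>\<^bsub>M\<^esub> \<one>\<^bsub>M\<^esub> N) \<cdot>\<^bsub>M\<^esub>
           inv\<^bsub>M\<^esub> (mod_associator M (Y, X, N))) \<and>
      (\<forall>X \<in> Obj B. \<forall>Y \<in> Obj B. \<forall>N \<in> Obj M.
         E (Y \<otimes>\<^bsub>B\<^esub> X, N) =
           inv\<^bsub>M\<^esub> (mod_associator M (Y, X, N)) \<cdot>\<^bsub>M\<^esub>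
           E (Y, X \<rhd>\<^bsub>M\<^esub> N) \<cdot>\<^bsub>M\<^esub>
           (\<one>\<^bsub>B\<^esub> Y \<diamondop>\<^bsub>M\<^esub> E (X, N)) \<cdot>\<^bsub>M\<^esub>
           mod_associator M (Y, X, N))}"

definition anti_twists :: "('o, 'a, 'z) braided_category_scheme \<Rightarrow> ('o \<Rightarrow> 'a) set" where
  "anti_twists B =
    {\<sigma> \<in> natural_automorphisms B B id_functor.
      \<forall>X \<in> Obj B. \<forall>Y \<in> Obj B.
        \<sigma> (X \<otimes>\<^bsub>B\<^esub> Y) = inv\<^bsub>B\<^esub> (double_braiding B (X, Y)) \<cdot>\<^bsub>B\<^esub> (\<sigma> X \<odot>\<^bsub>B\<^esub> \<sigma> Y)}"

text \<open>Evaluation at the unit object: \<open>\<sigma>\<^sub>X\<close> is \<open>E(X, \<I>)\<close> transported along \<open>X \<otimes> \<I> \<cong> X\<close>.\<close>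

definition restrict_to_unit ::
  "('o, 'a, 'z) braided_category_scheme \<Rightarrow> ('o \<times> 'o \<Rightarrow> 'a) \<Rightarrow> 'o \<Rightarrow> 'a" where
  "restrict_to_unit B E =
    (\<lambda>X \<in> Obj B. right_unitor B X \<cdot>\<^bsub>B\<^esub> E (X, \<I>\<^bsub>B\<^esub>) \<cdot>\<^bsub>B\<^esub> inv\<^bsub>B\<^esub> (right_unitor B X))"

end

theory Submission
  imports Defs
begin

text \<open>
  Suppress associators, write \<open>\<tau>\<^sup>2\<close> for the double braiding and \<open>\<sigma> X\<close> for the restriction of a
  braided structure \<open>E\<close> to \<open>E(X, \<I>)\<close>. Taking \<open>N = \<I>\<close> in the first axiom for \<open>E\<close> gives
  \<open>E(Y, X) = \<tau>\<^sup>-\<^sup>1(X, Y) (\<one> X \<otimes> \<sigma> Y) \<tau>\<^sup>-\<^sup>1(Y, X)\<close>, and pulling \<open>\<sigma> Y\<close> through the braiding turns this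
  into \<open>E(Y, X) = \<tau>\<^sup>-\<^sup>2(Y, X) (\<sigma> Y \<otimes> \<one> X)\<close>. Hence \<open>E\<close> is determined by \<open>\<sigma>\<close>, and the second axiom
  at \<open>N = \<I>\<close> becomes the anti-twist equation. This is the content of
  \<open>determined_by_restriction\<close> and \<open>restriction_tensor\<close>; because the unitors are not identities, both
  need Kelly's coherence lemma \<open>runit_tensor\<close>.

  Conversely, let \<open>\<sigma>\<close> be an anti-twist and define \<open>E\<close> by that formula. The first axiom then says
  that \<open>\<tau>\<^sup>2(Y, X \<otimes> N)\<close>, where the strand \<open>Y\<close> passes around \<open>X\<close> and \<open>N\<close> and back, factors as
  \<open>\<tau>(X, Y)\<close>, \<open>\<tau>\<^sup>2(Y, N)\<close>, \<open>\<tau>(Y, X)\<close>; this is the product of the two hexagons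
  (\<open>dbraid_tensor_right\<close>). The second axiom comes down to an identity of pure braids on three
  strands,
  \<open>(\<one> Y \<otimes> \<tau>\<^sup>2(X, N)) \<tau>\<^sup>2(Y, X \<otimes> N) = (\<tau>\<^sup>2(Y, X) \<otimes> \<one> N) \<tau>\<^sup>2(Y \<otimes> X, N)\<close>: both sides are the full
  twist (\<open>full_twist\<close>). Finally, \<open>E(X, \<I>)\<close> gives back \<open>\<sigma> X\<close> because \<open>\<tau>\<^sup>2(X, \<I>)\<close> is the identity
  (\<open>dbraid_unit\<close>), which follows from the hexagons and the coherence lemmas for the unitors.
\<close>


section \<open>Calculus of composition and inverses\<close>

context category
begin

lemma ident_simps [simp]:
  assumes "X \<in> Obj C"
  shows "\<one> X \<in> Arr C" "Dom C (\<one> X) = X" "Cod C (\<one> X) = X"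
  using ident_closed[OF assms] by (simp_all add: Hom_def)

lemma comp_simps [simp]:
  assumes "f \<in> Arr C" "g \<in> Arr C" "Cod C f = Dom C g"
  shows "g \<cdot> f \<in> Arr C" "Dom C (g \<cdot> f) = Dom C f" "Cod C (g \<cdot> f) = Cod C g"
  using comp_closed[of f "Dom C f" "Cod C f" g "Cod C g"] assms by (simp_all add: Hom_def)

lemma comp_assoc_arr [simp]:
  assumes "f \<in> Arr C" "g \<in> Arr C" "h \<in> Arr C" "Cod C f = Dom C g" "Cod C g = Dom C h"
  shows "(h \<cdot> g) \<cdot> f = h \<cdot> (g \<cdot> f)"
  using comp_assoc[of f "Dom C f" "Cod C f" g "Cod C g" h "Cod C h"] assms by (simp add: Hom_def)

lemma comp_ident_arr [simp]:
  assumes "f \<in> Arr C"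
  shows "Cod C f = Y \<Longrightarrow> \<one> Y \<cdot> f = f" "Dom C f = X \<Longrightarrow> f \<cdot> \<one> X = f"
  using comp_ident_left[of f "Dom C f" "Cod C f"] comp_ident_right[of f "Dom C f" "Cod C f"] assms
  by (auto simp: Hom_def)

lemmas obj_closed [simp] = dom_closed cod_closed

text \<open>Composites are kept bracketed to the right; this turns an equation between composites of two
  arrows into a rewrite step inside a longer composite.\<close>

lemma comp_tail:
  assumes "g \<cdot> f = k" "f \<in> Arr C" "g \<in> Arr C" "Cod C f = Dom C g" "h \<in> Arr C" "Cod C h = Dom C f"
  shows "g \<cdot> (f \<cdot> h) = k \<cdot> h"
  using assms by (metis comp_assoc_arr)

lemma inverse_arrows_iff:
  "inverse_arrows C f g \<longleftrightarrow> f \<in> Arr C \<and> g \<in> Arr C \<and> Dom C g = Cod C f \<and> Cod C g = Dom C f \<and>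
     g \<cdot> f = \<one> (Dom C f) \<and> f \<cdot> g = \<one> (Cod C f)"
  by (auto simp: inverse_arrows_def Hom_def)

lemma inv_unique:
  assumes "inverse_arrows C f g"
  shows "inv f = g"
  unfolding arr_inv_def
proof (rule the_equality[of "inverse_arrows C f", OF assms])
  fix h assume h: "inverse_arrows C f h"
  have "h = h \<cdot> (f \<cdot> g)"
    using assms h by (simp add: inverse_arrows_iff)
  also have "\<dots> = (h \<cdot> f) \<cdot> g"
    using assms h by (subst comp_assoc_arr) (simp_all add: inverse_arrows_iff)
  also have "\<dots> = g"
    using assms h by (simp add: inverse_arrows_iff)
  finally show "h = g" .
qed

lemma inverse_arrows_inv: "is_iso C f \<Longrightarrow> inverse_arrows C f (inv f)"
  using inv_unique by (auto simp: is_iso_def)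

lemma iso_arr: "is_iso C f \<Longrightarrow> f \<in> Arr C"
  by (auto simp: is_iso_def inverse_arrows_def)

lemma inv_simps [simp]:
  assumes "is_iso C f"
  shows "inv f \<in> Arr C" "Dom C (inv f) = Cod C f" "Cod C (inv f) = Dom C f"
    "inv f \<cdot> f = \<one> (Dom C f)" "f \<cdot> inv f = \<one> (Cod C f)"
  using inverse_arrows_inv[OF assms] by (simp_all add: inverse_arrows_iff)

lemma inv_cancel [simp]:
  assumes "is_iso C f" "h \<in> Arr C"
  shows "Cod C h = Dom C f \<Longrightarrow> inv f \<cdot> (f \<cdot> h) = h"
    "Cod C h = Cod C f \<Longrightarrow> f \<cdot> (inv f \<cdot> h) = h"
  using assms iso_arr[OF assms(1)]
  by (simp_all flip: comp_assoc_arr)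

lemma inverse_arrows_iso: "inverse_arrows C f g \<Longrightarrow> is_iso C f"
  by (auto simp: is_iso_def)

lemma iso_inv [simp]:
  assumes "is_iso C f"
  shows "is_iso C (inv f)" "inv (inv f) = f"
proof -
  have "inverse_arrows C (inv f) f"
    using assms iso_arr[OF assms] by (simp add: inverse_arrows_iff)
  then show "is_iso C (inv f)" "inv (inv f) = f"
    by (simp_all add: inverse_arrows_iso inv_unique)
qed

lemma iso_comp [simp]:
  assumes "is_iso C f" "is_iso C g" "Cod C f = Dom C g"
  shows "is_iso C (g \<cdot> f)" "inv (g \<cdot> f) = inv f \<cdot> inv g"
proof -
  have "inverse_arrows C (g \<cdot> f) (inv f \<cdot> inv g)"
    using assms iso_arr[OF assms(1)] iso_arr[OF assms(2)] by (simp add: inverse_arrows_iff)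
  then show "is_iso C (g \<cdot> f)" "inv (g \<cdot> f) = inv f \<cdot> inv g"
    by (simp_all add: inverse_arrows_iso inv_unique)
qed

lemma iso_ident [simp]:
  assumes "X \<in> Obj C"
  shows "is_iso C (\<one> X)" "inv (\<one> X) = \<one> X"
proof -
  have "inverse_arrows C (\<one> X) (\<one> X)"
    using assms by (simp add: inverse_arrows_iff)
  then show "is_iso C (\<one> X)" "inv (\<one> X) = \<one> X"
    by (simp_all add: inverse_arrows_iso inv_unique)
qed

lemma iso_left_cancel:
  assumes "is_iso C h" "f \<in> Arr C" "g \<in> Arr C" "Cod C f = Dom C h" "Cod C g = Dom C h"
    "h \<cdot> f = h \<cdot> g"
  shows "f = g"
  using inv_cancel(1)[of h f] inv_cancel(1)[of h g] assms by metis

lemma iso_right_cancel: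
  assumes "is_iso C h" "f \<in> Arr C" "g \<in> Arr C" "Dom C f = Cod C h" "Dom C g = Cod C h"
    "f \<cdot> h = g \<cdot> h"
  shows "f = g"
proof -
  have "k = (k \<cdot> h) \<cdot> inv h" if "k \<in> Arr C" "Dom C k = Cod C h" for k
    using that assms(1) iso_arr[OF assms(1)] by (subst comp_assoc_arr) simp_all
  then show ?thesis using assms by metis
qed

text \<open>Applied to naturality squares, this gives naturality of the inverses of a natural family.\<close>

lemma inv_square:
  assumes "is_iso C p" "is_iso C q" "f \<in> Arr C" "g \<in> Arr C"
    "Cod C f = Dom C q" "Dom C f = Dom C p" "Dom C g = Cod C p" "Cod C g = Cod C q"
    "q \<cdot> f = g \<cdot> p"
  shows "inv q \<cdot> g = f \<cdot> inv p"
proof -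
  have "inv q \<cdot> g = inv q \<cdot> ((g \<cdot> p) \<cdot> inv p)"
    using assms iso_arr[OF assms(1)] by simp
  also have "\<dots> = inv q \<cdot> ((q \<cdot> f) \<cdot> inv p)"
    using assms by simp
  also have "\<dots> = f \<cdot> inv p"
    using assms(1-8) iso_arr[OF assms(2)] by simp
  finally show ?thesis .
qed

end


section \<open>Monoidal categories\<close>

context monoidal_category
begin

abbreviation assoc (\<open>\<alpha>\<close>) where "\<alpha> X Y Z \<equiv> associator B (X, Y, Z)"
abbreviation lunit (\<open>\<l>\<close>) where "\<l> X \<equiv> left_unitor B X"
abbreviation runit (\<open>\<r>\<close>) where "\<r> X \<equiv> right_unitor B X"

lemma unit_obj [simp]: "\<I> \<in> Obj B"
  by (rule unit_closed)

lemma tensor_obj_closed [simp]: "X \<in> Obj B \<Longrightarrow> Y \<in> Obj B \<Longrightarrow> X \<otimes> Y \<in> Obj B"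
  using tensor_functor by (simp add: is_functor_def prod_category_def)

lemma tensor_simps [simp]:
  assumes "f \<in> Arr B" "g \<in> Arr B"
  shows "f \<odot> g \<in> Arr B" "Dom B (f \<odot> g) = Dom B f \<otimes> Dom B g" "Cod B (f \<odot> g) = Cod B f \<otimes> Cod B g"
  using tensor_functor assms by (simp_all add: is_functor_def prod_category_def Hom_def)

lemma tensor_ident [simp]: "X \<in> Obj B \<Longrightarrow> Y \<in> Obj B \<Longrightarrow> \<one> X \<odot> \<one> Y = \<one> (X \<otimes> Y)"
  using tensor_functor by (simp add: is_functor_def prod_category_def)

lemma tensor_comp:
  assumes "f \<in> Arr B" "g \<in> Arr B" "f' \<in> Arr B" "g' \<in> Arr B" "Cod B f = Dom B f'" "Cod B g = Dom B g'"
  shows "(f' \<odot> g') \<cdot> (f \<odot> g) = (f' \<cdot> f) \<odot> (g' \<cdot> g)"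
  using tensor_functor assms by (force simp add: is_functor_def prod_category_def)

lemma tensor_comp_tail:
  assumes "f \<in> Arr B" "g \<in> Arr B" "f' \<in> Arr B" "g' \<in> Arr B" "Cod B f = Dom B f'" "Cod B g = Dom B g'"
    "h \<in> Arr B" "Cod B h = Dom B f \<otimes> Dom B g"
  shows "(f' \<odot> g') \<cdot> ((f \<odot> g) \<cdot> h) = ((f' \<cdot> f) \<odot> (g' \<cdot> g)) \<cdot> h"
  using assms by (intro comp_tail tensor_comp) simp_all

lemma iso_tensor [simp]:
  assumes "is_iso B f" "is_iso B g"
  shows "is_iso B (f \<odot> g)" "inv (f \<odot> g) = inv f \<odot> inv g"
proof -
  have "inverse_arrows B (f \<odot> g) (inv f \<odot> inv g)"
    using assms iso_arr[OF assms(1)] iso_arr[OF assms(2)]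
    by (simp add: inverse_arrows_iff tensor_comp)
  then show "is_iso B (f \<odot> g)" "inv (f \<odot> g) = inv f \<odot> inv g"
    by (simp_all add: inverse_arrows_iso inv_unique)
qed

lemma assoc_simps [simp]:
  assumes "X \<in> Obj B" "Y \<in> Obj B" "Z \<in> Obj B"
  shows "\<alpha> X Y Z \<in> Arr B" "Dom B (\<alpha> X Y Z) = (X \<otimes> Y) \<otimes> Z" "Cod B (\<alpha> X Y Z) = X \<otimes> (Y \<otimes> Z)"
    "is_iso B (\<alpha> X Y Z)"
  using associator_natural assms by (simp_all add: natural_iso_def prod_category_def Hom_def)

lemma assoc_nat:
  assumes "f \<in> Arr B" "g \<in> Arr B" "h \<in> Arr B" "Dom B f = X" "Dom B g = Y" "Dom B h = Z"
    "Cod B f = X'" "Cod B g = Y'" "Cod B h = Z'"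
  shows "\<alpha> X' Y' Z' \<cdot> ((f \<odot> g) \<odot> h) = (f \<odot> (g \<odot> h)) \<cdot> \<alpha> X Y Z"
  using associator_natural assms by (force simp add: natural_iso_def prod_category_def)

lemma lunit_simps [simp]:
  assumes "X \<in> Obj B"
  shows "\<l> X \<in> Arr B" "Dom B (\<l> X) = \<I> \<otimes> X" "Cod B (\<l> X) = X" "is_iso B (\<l> X)"
  using left_unitor_natural assms by (simp_all add: natural_iso_def Hom_def id_functor_def)

lemma runit_simps [simp]:
  assumes "X \<in> Obj B"
  shows "\<r> X \<in> Arr B" "Dom B (\<r> X) = X \<otimes> \<I>" "Cod B (\<r> X) = X" "is_iso B (\<r> X)"
  using right_unitor_natural assms by (simp_all add: natural_iso_def Hom_def id_functor_def)

lemma lunit_nat: "f \<in> Arr B \<Longrightarrow> \<l> (Cod B f) \<cdot> (\<one> \<I> \<odot> f) = f \<cdot> \<l> (Dom B f)"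
  using left_unitor_natural by (simp add: natural_iso_def id_functor_def)

lemma runit_nat: "f \<in> Arr B \<Longrightarrow> \<r> (Cod B f) \<cdot> (f \<odot> \<one> \<I>) = f \<cdot> \<r> (Dom B f)"
  using right_unitor_natural by (simp add: natural_iso_def id_functor_def)

text \<open>By naturality, tensoring with \<open>\<I>\<close> is conjugation by a unitor, so it can be undone. The
  coherence lemmas below are proved after tensoring with an extra \<open>\<I>\<close>, where the pentagon and the
  triangle apply.\<close>
lemma unit_tensor_faithful:
  assumes "f \<in> Arr B" "g \<in> Arr B" "Dom B f = Dom B g" "Cod B f = Cod B g" "\<one> \<I> \<odot> f = \<one> \<I> \<odot> g"
  shows "f = g"
  using lunit_nat[of f] lunit_nat[of g] assms
  by (intro iso_right_cancel[of "\<l> (Dom B f)" f g]) simp_all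

lemma tensor_unit_faithful:
  assumes "f \<in> Arr B" "g \<in> Arr B" "Dom B f = Dom B g" "Cod B f = Cod B g" "f \<odot> \<one> \<I> = g \<odot> \<one> \<I>"
  shows "f = g"
  using runit_nat[of f] runit_nat[of g] assms
  by (intro iso_right_cancel[of "\<r> (Dom B f)" f g]) simp_all

text \<open>Kelly's argument: in the pentagon for \<open>(X, Y, \<I>, \<I>)\<close>, the left unitor of the last factor meets
  the associators \<open>\<alpha> (X \<otimes> Y) \<I> \<I>\<close> and \<open>\<alpha> Y \<I> \<I>\<close>, and the triangle turns these into the right
  unitors of \<open>X \<otimes> Y\<close> and \<open>Y\<close>.\<close>
lemma runit_tensor:
  assumes [simp]: "X \<in> Obj B" "Y \<in> Obj B"
  shows "\<r> (X \<otimes> Y) = (\<one> X \<odot> \<r> Y) \<cdot> \<alpha> X Y \<I>"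
proof (rule tensor_unit_faithful)
  let ?l = "\<one> X \<odot> (\<one> Y \<odot> \<l> \<I>)"
  have "\<alpha> X Y \<I> \<cdot> (\<r> (X \<otimes> Y) \<odot> \<one> \<I>) = \<alpha> X Y \<I> \<cdot> ((\<one> (X \<otimes> Y) \<odot> \<l> \<I>) \<cdot> \<alpha> (X \<otimes> Y) \<I> \<I>)"
    by (simp add: triangle)
  also have "\<dots> = ?l \<cdot> (\<alpha> X Y (\<I> \<otimes> \<I>) \<cdot> \<alpha> (X \<otimes> Y) \<I> \<I>)"
    using assoc_nat[of "\<one> X" "\<one> Y" "\<l> \<I>" X Y "\<I> \<otimes> \<I>" X Y \<I>]
    by (simp flip: comp_assoc_arr)
  also have "\<dots> = ?l \<cdot> ((\<one> X \<odot> \<alpha> Y \<I> \<I>) \<cdot> \<alpha> X (Y \<otimes> \<I>) \<I> \<cdot> (\<alpha> X Y \<I> \<odot> \<one> \<I>))"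
    by (simp add: pentagon)
  also have "\<dots> = (\<one> X \<odot> (\<r> Y \<odot> \<one> \<I>)) \<cdot> \<alpha> X (Y \<otimes> \<I>) \<I> \<cdot> (\<alpha> X Y \<I> \<odot> \<one> \<I>)"
    by (simp add: tensor_comp_tail triangle)
  also have "\<dots> = \<alpha> X Y \<I> \<cdot> (((\<one> X \<odot> \<r> Y) \<odot> \<one> \<I>) \<cdot> (\<alpha> X Y \<I> \<odot> \<one> \<I>))"
    using assoc_nat[of "\<one> X" "\<r> Y" "\<one> \<I>" X "Y \<otimes> \<I>" \<I> X Y \<I>] by (simp flip: comp_assoc_arr)
  also have "\<dots> = \<alpha> X Y \<I> \<cdot> (((\<one> X \<odot> \<r> Y) \<cdot> \<alpha> X Y \<I>) \<odot> \<one> \<I>)"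
    by (simp add: tensor_comp)
  finally show "\<r> (X \<otimes> Y) \<odot> \<one> \<I> = ((\<one> X \<odot> \<r> Y) \<cdot> \<alpha> X Y \<I>) \<odot> \<one> \<I>"
    by (rule iso_left_cancel[rotated -1]) simp_all
qed simp_all

lemma runit_tensor_inv:
  assumes [simp]: "X \<in> Obj B" "Y \<in> Obj B"
  shows "\<r> (X \<otimes> Y) \<cdot> inv (\<alpha> X Y \<I>) = \<one> X \<odot> \<r> Y"
  by (simp add: runit_tensor)

text \<open>The mirrored coherence lemma, from the pentagon for \<open>(\<I>, \<I>, X, Y)\<close>.\<close>
lemma lunit_tensor:
  assumes [simp]: "X \<in> Obj B" "Y \<in> Obj B"
  shows "\<l> (X \<otimes> Y) \<cdot> \<alpha> \<I> X Y = \<l> X \<odot> \<one> Y"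
proof (rule unit_tensor_faithful)
  let ?k = "\<alpha> \<I> (\<I> \<otimes> X) Y \<cdot> (\<alpha> \<I> \<I> X \<odot> \<one> Y)"
  have "(\<one> \<I> \<odot> (\<l> (X \<otimes> Y) \<cdot> \<alpha> \<I> X Y)) \<cdot> ?k
      = (\<one> \<I> \<odot> \<l> (X \<otimes> Y)) \<cdot> ((\<one> \<I> \<odot> \<alpha> \<I> X Y) \<cdot> ?k)"
    by (simp add: tensor_comp_tail)
  also have "\<dots> = (\<one> \<I> \<odot> \<l> (X \<otimes> Y)) \<cdot> (\<alpha> \<I> \<I> (X \<otimes> Y) \<cdot> \<alpha> (\<I> \<otimes> \<I>) X Y)"
    by (simp add: pentagon)
  also have "\<dots> = (\<r> \<I> \<odot> \<one> (X \<otimes> Y)) \<cdot> \<alpha> (\<I> \<otimes> \<I>) X Y"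
    by (simp add: triangle flip: comp_assoc_arr)
  also have "\<dots> = \<alpha> \<I> X Y \<cdot> ((\<r> \<I> \<odot> \<one> X) \<odot> \<one> Y)"
    using assoc_nat[of "\<r> \<I>" "\<one> X" "\<one> Y" "\<I> \<otimes> \<I>" X Y \<I> X Y] by simp
  also have "\<dots> = \<alpha> \<I> X Y \<cdot> (((\<one> \<I> \<odot> \<l> X) \<odot> \<one> Y) \<cdot> (\<alpha> \<I> \<I> X \<odot> \<one> Y))"
    by (simp add: tensor_comp flip: triangle)
  also have "\<dots> = (\<one> \<I> \<odot> (\<l> X \<odot> \<one> Y)) \<cdot> ?k"
    using assoc_nat[of "\<one> \<I>" "\<l> X" "\<one> Y" \<I> "\<I> \<otimes> X" Y \<I> X Y] by (simp flip: comp_assoc_arr)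
  finally show "\<one> \<I> \<odot> (\<l> (X \<otimes> Y) \<cdot> \<alpha> \<I> X Y) = \<one> \<I> \<odot> (\<l> X \<odot> \<one> Y)"
    by (rule iso_right_cancel[rotated -1]) simp_all
qed simp_all

lemma assoc_inv_nat:
  assumes "f \<in> Arr B" "g \<in> Arr B" "h \<in> Arr B" "Dom B f = X" "Dom B g = Y" "Dom B h = Z"
    "Cod B f = X'" "Cod B g = Y'" "Cod B h = Z'"
  shows "inv (\<alpha> X' Y' Z') \<cdot> (f \<odot> (g \<odot> h)) = ((f \<odot> g) \<odot> h) \<cdot> inv (\<alpha> X Y Z)"
  using assms assoc_nat[OF assms] by (intro inv_square) auto

end


section \<open>Braided categories\<close>

context braided_category
begin

abbreviation braid (\<open>\<tau>\<close>) where "\<tau> X Y \<equiv> braiding B (X, Y)"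
abbreviation dbraid (\<open>\<delta>\<close>) where "\<delta> X Y \<equiv> double_braiding B (X, Y)"

lemma braid_simps [simp]:
  assumes "X \<in> Obj B" "Y \<in> Obj B"
  shows "\<tau> X Y \<in> Arr B" "Dom B (\<tau> X Y) = X \<otimes> Y" "Cod B (\<tau> X Y) = Y \<otimes> X" "is_iso B (\<tau> X Y)"
  using braiding_natural assms by (simp_all add: natural_iso_def prod_category_def Hom_def)

lemma braid_nat:
  assumes "f \<in> Arr B" "g \<in> Arr B" "Dom B f = X" "Dom B g = Y" "Cod B f = X'" "Cod B g = Y'"
  shows "\<tau> X' Y' \<cdot> (f \<odot> g) = (g \<odot> f) \<cdot> \<tau> X Y"
  using braiding_natural assms by (force simp add: natural_iso_def prod_category_def)

lemma dbraid_eq: "\<delta> X Y = \<tau> Y X \<cdot> \<tau> X Y"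
  by (simp add: double_braiding_def)

lemma dbraid_simps [simp]:
  assumes "X \<in> Obj B" "Y \<in> Obj B"
  shows "\<delta> X Y \<in> Arr B" "Dom B (\<delta> X Y) = X \<otimes> Y" "Cod B (\<delta> X Y) = X \<otimes> Y" "is_iso B (\<delta> X Y)"
  using assms by (simp_all add: dbraid_eq)

lemma dbraid_nat:
  assumes "f \<in> Arr B" "g \<in> Arr B" "Dom B f = X" "Dom B g = Y" "Cod B f = X'" "Cod B g = Y'"
  shows "\<delta> X' Y' \<cdot> (f \<odot> g) = (f \<odot> g) \<cdot> \<delta> X Y"
  unfolding dbraid_eq using assms braid_nat[OF assms] braid_nat[of g f Y X Y' X']
  by (auto simp: comp_tail[OF braid_nat])

lemma braid_tensor_right:
  assumes [simp]: "X \<in> Obj B" "Y \<in> Obj B" "Z \<in> Obj B"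
  shows "\<tau> X (Y \<otimes> Z) = inv (\<alpha> Y Z X) \<cdot> (\<one> Y \<odot> \<tau> X Z) \<cdot> \<alpha> Y X Z \<cdot> (\<tau> X Y \<odot> \<one> Z) \<cdot> inv (\<alpha> X Y Z)"
proof -
  have "\<tau> X (Y \<otimes> Z) = inv (\<alpha> Y Z X) \<cdot> (\<alpha> Y Z X \<cdot> \<tau> X (Y \<otimes> Z) \<cdot> \<alpha> X Y Z) \<cdot> inv (\<alpha> X Y Z)"
    by simp
  then show ?thesis
    by (subst (asm) hexagon) simp_all
qed

lemma braid_tensor_left:
  assumes [simp]: "X \<in> Obj B" "Y \<in> Obj B" "Z \<in> Obj B"
  shows "\<tau> (X \<otimes> Y) Z = \<alpha> Z X Y \<cdot> (\<tau> X Z \<odot> \<one> Y) \<cdot> inv (\<alpha> X Z Y) \<cdot> (\<one> X \<odot> \<tau> Y Z) \<cdot> \<alpha> X Y Z"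
proof -
  have "\<tau> (X \<otimes> Y) Z = \<alpha> Z X Y \<cdot> (inv (\<alpha> Z X Y) \<cdot> \<tau> (X \<otimes> Y) Z \<cdot> inv (\<alpha> X Y Z)) \<cdot> \<alpha> X Y Z"
    by simp
  then show ?thesis
    by (subst (asm) hexagon') simp_all
qed

text \<open>The hexagon with both last objects equal to \<open>\<I>\<close>, composed with a left unitor. Naturality and
  the coherence lemma remove the associators and leave a common factor \<open>\<tau> X \<I>\<close> on both sides,
  which cancels.\<close>
lemma lunit_braid:
  assumes [simp]: "X \<in> Obj B"
  shows "\<l> X \<cdot> \<tau> X \<I> = \<r> X"
proof (rule tensor_unit_faithful)
  let ?k = "\<alpha> \<I> X \<I> \<cdot> (\<tau> X \<I> \<odot> \<one> \<I>)"
  have "\<tau> X \<I> \<cdot> (\<r> X \<odot> \<one> \<I>) = (\<tau> X \<I> \<cdot> (\<one> X \<odot> \<l> \<I>)) \<cdot> \<alpha> X \<I> \<I>"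
    by (simp add: triangle)
  also have "\<dots> = (\<l> \<I> \<odot> \<one> X) \<cdot> (\<tau> X (\<I> \<otimes> \<I>) \<cdot> \<alpha> X \<I> \<I>)"
    by (subst braid_nat[where X = X and Y = "\<I> \<otimes> \<I>"]) simp_all
  also have "\<dots> = \<l> (\<I> \<otimes> X) \<cdot> (\<alpha> \<I> \<I> X \<cdot> \<tau> X (\<I> \<otimes> \<I>) \<cdot> \<alpha> X \<I> \<I>)"
    by (simp flip: lunit_tensor)
  also have "\<dots> = (\<l> (\<I> \<otimes> X) \<cdot> (\<one> \<I> \<odot> \<tau> X \<I>)) \<cdot> ?k"
    by (subst hexagon) simp_all
  also have "\<dots> = \<tau> X \<I> \<cdot> (\<l> (X \<otimes> \<I>) \<cdot> \<alpha> \<I> X \<I>) \<cdot> (\<tau> X \<I> \<odot> \<one> \<I>)"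
    using lunit_nat[of "\<tau> X \<I>"] by simp
  also have "\<dots> = \<tau> X \<I> \<cdot> ((\<l> X \<odot> \<one> \<I>) \<cdot> (\<tau> X \<I> \<odot> \<one> \<I>))"
    by (subst lunit_tensor) simp_all
  finally have eq: "\<tau> X \<I> \<cdot> (\<r> X \<odot> \<one> \<I>) = \<tau> X \<I> \<cdot> ((\<l> X \<cdot> \<tau> X \<I>) \<odot> \<one> \<I>)"
    by (simp add: tensor_comp)
  show "(\<l> X \<cdot> \<tau> X \<I>) \<odot> \<one> \<I> = \<r> X \<odot> \<one> \<I>"
    by (rule iso_left_cancel[OF _ _ _ _ _ eq[symmetric]]) simp_all
qed simp_all

text \<open>The same computation for the second hexagon, with its first two objects equal to \<open>\<I>\<close>.\<close>
lemma runit_braid: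
  assumes [simp]: "X \<in> Obj B"
  shows "\<r> X \<cdot> \<tau> \<I> X = \<l> X"
proof (rule unit_tensor_faithful)
  have "\<tau> \<I> X \<cdot> (\<one> \<I> \<odot> \<l> X) = (\<tau> \<I> X \<cdot> (\<r> \<I> \<odot> \<one> X)) \<cdot> inv (\<alpha> \<I> \<I> X)"
    by (simp flip: triangle)
  also have "\<dots> = (\<one> X \<odot> \<r> \<I>) \<cdot> (\<tau> (\<I> \<otimes> \<I>) X \<cdot> inv (\<alpha> \<I> \<I> X))"
    by (subst braid_nat[where X = "\<I> \<otimes> \<I>" and Y = X]) simp_all
  also have "\<dots> = \<r> (X \<otimes> \<I>) \<cdot> (inv (\<alpha> X \<I> \<I>) \<cdot> \<tau> (\<I> \<otimes> \<I>) X \<cdot> inv (\<alpha> \<I> \<I> X))"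
    by (simp flip: runit_tensor_inv)
  also have "\<dots> = (\<r> (X \<otimes> \<I>) \<cdot> (\<tau> \<I> X \<odot> \<one> \<I>)) \<cdot> inv (\<alpha> \<I> X \<I>) \<cdot> (\<one> \<I> \<odot> \<tau> \<I> X)"
    by (subst hexagon') simp_all
  also have "\<dots> = \<tau> \<I> X \<cdot> (\<r> (\<I> \<otimes> X) \<cdot> inv (\<alpha> \<I> X \<I>)) \<cdot> (\<one> \<I> \<odot> \<tau> \<I> X)"
    using runit_nat[of "\<tau> \<I> X"] by simp
  also have "\<dots> = \<tau> \<I> X \<cdot> ((\<one> \<I> \<odot> \<r> X) \<cdot> (\<one> \<I> \<odot> \<tau> \<I> X))"
    by (subst runit_tensor_inv) simp_all
  finally have eq: "\<tau> \<I> X \<cdot> (\<one> \<I> \<odot> \<l> X) = \<tau> \<I> X \<cdot> (\<one> \<I> \<odot> (\<r> X \<cdot> \<tau> \<I> X))"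
    by (simp add: tensor_comp)
  show "\<one> \<I> \<odot> (\<r> X \<cdot> \<tau> \<I> X) = \<one> \<I> \<odot> \<l> X"
    by (rule iso_left_cancel[OF _ _ _ _ _ eq[symmetric]]) simp_all
qed simp_all

lemma dbraid_unit:
  assumes [simp]: "X \<in> Obj B"
  shows "\<delta> X \<I> = \<one> (X \<otimes> \<I>)"
proof (rule iso_left_cancel[of "\<r> X"])
  have "\<r> X \<cdot> \<delta> X \<I> = (\<r> X \<cdot> \<tau> \<I> X) \<cdot> \<tau> X \<I>"
    by (simp add: dbraid_eq)
  also have "\<dots> = \<r> X \<cdot> \<one> (X \<otimes> \<I>)"
    by (subst runit_braid) (simp_all add: lunit_braid)
  finally show "\<r> X \<cdot> \<delta> X \<I> = \<r> X \<cdot> \<one> (X \<otimes> \<I>)" .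
qed simp_all

text \<open>The two hexagons compose, and the associators between them cancel: the strand \<open>Y\<close> crosses
  \<open>X\<close>, goes around \<open>N\<close>, and crosses back over \<open>X\<close>.\<close>
lemma dbraid_tensor_right:
  assumes [simp]: "Y \<in> Obj B" "X \<in> Obj B" "N \<in> Obj B"
  shows "\<delta> Y (X \<otimes> N) = \<alpha> Y X N \<cdot> (\<tau> X Y \<odot> \<one> N) \<cdot> inv (\<alpha> X Y N) \<cdot> (\<one> X \<odot> \<delta> Y N) \<cdot>
    \<alpha> X Y N \<cdot> (\<tau> Y X \<odot> \<one> N) \<cdot> inv (\<alpha> Y X N)"
  by (simp add: dbraid_eq braid_tensor_left braid_tensor_right tensor_comp_tail)

text \<open>The Yang--Baxter equation, with two of the three crossings on each side merged into a braiding with a tensor product.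
  Up to associators both sides equal \<open>\<tau> (Y \<otimes> X) Z\<close> precomposed with \<open>\<tau> X Y\<close>, the left one by
  the hexagons and the right one by naturality.\<close>
lemma half_twist:
  assumes [simp]: "X \<in> Obj B" "Y \<in> Obj B" "Z \<in> Obj B"
  shows "(\<tau> Y Z \<odot> \<one> X) \<cdot> \<tau> X (Y \<otimes> Z) =
    inv (\<alpha> Z Y X) \<cdot> (\<one> Z \<odot> \<tau> X Y) \<cdot> \<tau> (X \<otimes> Y) Z \<cdot> inv (\<alpha> X Y Z)"
proof -
  have "(\<tau> Y Z \<odot> \<one> X) \<cdot> \<tau> X (Y \<otimes> Z) =
      inv (\<alpha> Z Y X) \<cdot> \<tau> (Y \<otimes> X) Z \<cdot> (\<tau> X Y \<odot> \<one> Z) \<cdot> inv (\<alpha> X Y Z)"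
    by (simp add: braid_tensor_left braid_tensor_right)
  also have "\<tau> (Y \<otimes> X) Z \<cdot> (\<tau> X Y \<odot> \<one> Z) \<cdot> inv (\<alpha> X Y Z) =
      (\<tau> (Y \<otimes> X) Z \<cdot> (\<tau> X Y \<odot> \<one> Z)) \<cdot> inv (\<alpha> X Y Z)"
    by simp
  also have "\<dots> = (\<one> Z \<odot> \<tau> X Y) \<cdot> \<tau> (X \<otimes> Y) Z \<cdot> inv (\<alpha> X Y Z)"
    by (subst braid_nat[where X = "X \<otimes> Y" and Y = Z]) simp_all
  finally show ?thesis .
qed

text \<open>By naturality of the braiding with respect to \<open>\<tau> X N\<close>, respectively \<open>\<tau> Y X\<close>, both sides are
  a half twist from \<open>Y \<otimes> X \<otimes> N\<close> to \<open>N \<otimes> X \<otimes> Y\<close> followed by a half twist back. The half twists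
  on the two sides agree by the previous lemma.\<close>
lemma full_twist:
  assumes [simp]: "Y \<in> Obj B" "X \<in> Obj B" "N \<in> Obj B"
  shows "(\<one> Y \<odot> \<delta> X N) \<cdot> \<delta> Y (X \<otimes> N) =
    \<alpha> Y X N \<cdot> (\<delta> Y X \<odot> \<one> N) \<cdot> \<delta> (Y \<otimes> X) N \<cdot> inv (\<alpha> Y X N)"
proof -
  \<comment> \<open>the half twist back, from \<open>N \<otimes> X \<otimes> Y\<close> to \<open>Y \<otimes> X \<otimes> N\<close>\<close>
  have second: "(\<one> Y \<odot> \<tau> N X) \<cdot> \<tau> (N \<otimes> X) Y =
      \<alpha> Y X N \<cdot> (\<tau> X Y \<odot> \<one> N) \<cdot> \<tau> N (X \<otimes> Y) \<cdot> \<alpha> N X Y"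
    using half_twist[of N X Y] by (simp add: comp_tail[OF half_twist])
  have "(\<one> Y \<odot> \<delta> X N) \<cdot> \<delta> Y (X \<otimes> N) =
      (\<one> Y \<odot> \<tau> N X) \<cdot> ((\<one> Y \<odot> \<tau> X N) \<cdot> \<tau> (X \<otimes> N) Y) \<cdot> \<tau> Y (X \<otimes> N)"
    by (simp add: dbraid_eq tensor_comp_tail)
  also have "(\<one> Y \<odot> \<tau> X N) \<cdot> \<tau> (X \<otimes> N) Y = \<tau> (N \<otimes> X) Y \<cdot> (\<tau> X N \<odot> \<one> Y)"
    by (rule braid_nat[symmetric]) simp_all
  also have "(\<one> Y \<odot> \<tau> N X) \<cdot> (\<tau> (N \<otimes> X) Y \<cdot> (\<tau> X N \<odot> \<one> Y)) \<cdot> \<tau> Y (X \<otimes> N) =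
      ((\<one> Y \<odot> \<tau> N X) \<cdot> \<tau> (N \<otimes> X) Y) \<cdot> ((\<tau> X N \<odot> \<one> Y) \<cdot> \<tau> Y (X \<otimes> N))"
    by simp
  also have "\<dots> = \<alpha> Y X N \<cdot> (\<tau> X Y \<odot> \<one> N) \<cdot> (\<tau> N (X \<otimes> Y) \<cdot> (\<one> N \<odot> \<tau> Y X)) \<cdot>
      \<tau> (Y \<otimes> X) N \<cdot> inv (\<alpha> Y X N)"
    unfolding second half_twist[OF assms] by simp
  also have "\<tau> N (X \<otimes> Y) \<cdot> (\<one> N \<odot> \<tau> Y X) = (\<tau> Y X \<odot> \<one> N) \<cdot> \<tau> N (Y \<otimes> X)"
    by (rule braid_nat) simp_all
  finally show ?thesis
    by (simp add: dbraid_eq tensor_comp_tail)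
qed

end


section \<open>Anti-twists and braided structures\<close>

definition braided_structure_of ::
  "('o, 'a, 'z) braided_category_scheme \<Rightarrow> ('o \<Rightarrow> 'a) \<Rightarrow> 'o \<times> 'o \<Rightarrow> 'a" where
  "braided_structure_of B \<sigma> =
    (\<lambda>(Y, X) \<in> Obj B \<times> Obj B. inv\<^bsub>B\<^esub> (double_braiding B (Y, X)) \<cdot>\<^bsub>B\<^esub> (\<sigma> Y \<odot>\<^bsub>B\<^esub> \<one>\<^bsub>B\<^esub> X))"

context braided_category
begin

lemma inv_braiding_eq [simp]: "inv_braiding B (X, Y) = inv (\<tau> Y X)"
  by (simp add: inv_braiding_def)

lemma natural_automorphisms_id_iff:
  "\<sigma> \<in> natural_automorphisms B B id_functor \<longleftrightarrow> \<sigma> \<in> extensional (Obj B) \<and>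
    (\<forall>X \<in> Obj B. is_iso B (\<sigma> X) \<and> Dom B (\<sigma> X) = X \<and> Cod B (\<sigma> X) = X) \<and>
    (\<forall>f \<in> Arr B. \<sigma> (Cod B f) \<cdot> f = f \<cdot> \<sigma> (Dom B f))"
  by (auto simp: natural_automorphisms_def natural_iso_def id_functor_def Hom_def iso_arr)

lemma natural_automorphisms_tensor_iff:
  "E \<in> natural_automorphisms (B \<times>\<^sub>c B) B (tensor B) \<longleftrightarrow> E \<in> extensional (Obj B \<times> Obj B) \<and>
    (\<forall>Y \<in> Obj B. \<forall>X \<in> Obj B. is_iso B (E (Y, X)) \<and>
       Dom B (E (Y, X)) = Y \<otimes> X \<and> Cod B (E (Y, X)) = Y \<otimes> X) \<and>
    (\<forall>f \<in> Arr B. \<forall>g \<in> Arr B. E (Cod B f, Cod B g) \<cdot> (f \<odot> g) = (f \<odot> g) \<cdot> E (Dom B f, Dom B g))"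
  by (auto simp: natural_automorphisms_def natural_iso_def prod_category_def Hom_def iso_arr)

lemma natural_automorphisms_regular [simp]:
  "natural_automorphisms C (regular_module B) = natural_automorphisms C B"
  by (simp add: natural_automorphisms_def fun_eq_iff)

context
  fixes \<sigma>
  assumes \<sigma>: "\<sigma> \<in> anti_twists B"
begin

lemma anti_twist_simps [simp]:
  assumes "X \<in> Obj B"
  shows "is_iso B (\<sigma> X)" "\<sigma> X \<in> Arr B" "Dom B (\<sigma> X) = X" "Cod B (\<sigma> X) = X"
  using \<sigma> assms iso_arr by (auto simp: anti_twists_def natural_automorphisms_id_iff)

lemma anti_twist_nat:
  assumes "f \<in> Arr B" "Dom B f = X" "Cod B f = Y"
  shows "\<sigma> Y \<cdot> f = f \<cdot> \<sigma> X"
  using \<sigma> assms by (auto simp: anti_twists_def natural_automorphisms_id_iff)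

lemma anti_twist_tensor:
  assumes "X \<in> Obj B" "Y \<in> Obj B"
  shows "\<sigma> (X \<otimes> Y) = inv (\<delta> X Y) \<cdot> (\<sigma> X \<odot> \<sigma> Y)"
  using \<sigma> assms by (auto simp: anti_twists_def)

abbreviation \<epsilon> where "\<epsilon> \<equiv> braided_structure_of B \<sigma>"

lemma of_anti_twist_eq: "Y \<in> Obj B \<Longrightarrow> X \<in> Obj B \<Longrightarrow> \<epsilon> (Y, X) = inv (\<delta> Y X) \<cdot> (\<sigma> Y \<odot> \<one> X)"
  by (simp add: braided_structure_of_def)

lemma of_anti_twist_simps [simp]:
  assumes "Y \<in> Obj B" "X \<in> Obj B"
  shows "is_iso B (\<epsilon> (Y, X))" "\<epsilon> (Y, X) \<in> Arr B" "Dom B (\<epsilon> (Y, X)) = Y \<otimes> X" "Cod B (\<epsilon> (Y, X)) = Y \<otimes> X"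
  using assms by (simp_all add: of_anti_twist_eq)

text \<open>Naturality in both variables holds because \<open>\<epsilon>\<close> is composed of two natural families.\<close>
lemma of_anti_twist_natural: "\<epsilon> \<in> natural_automorphisms (B \<times>\<^sub>c B) B (tensor B)"
  unfolding natural_automorphisms_tensor_iff
proof (intro conjI ballI)
  show "\<epsilon> \<in> extensional (Obj B \<times> Obj B)"
    by (simp add: braided_structure_of_def)
  fix f g assume [simp]: "f \<in> Arr B" "g \<in> Arr B"
  let ?Y = "Dom B f" and ?X = "Dom B g" and ?Y' = "Cod B f" and ?X' = "Cod B g"
  have "\<epsilon> (?Y', ?X') \<cdot> (f \<odot> g) = inv (\<delta> ?Y' ?X') \<cdot> ((f \<odot> g) \<cdot> (\<sigma> ?Y \<odot> \<one> ?X))"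
    by (simp add: of_anti_twist_eq tensor_comp anti_twist_nat[of f ?Y ?Y'])
  also have "\<dots> = (inv (\<delta> ?Y' ?X') \<cdot> (f \<odot> g)) \<cdot> (\<sigma> ?Y \<odot> \<one> ?X)"
    by simp
  also have "inv (\<delta> ?Y' ?X') \<cdot> (f \<odot> g) = (f \<odot> g) \<cdot> inv (\<delta> ?Y ?X)"
    by (rule inv_square) (simp_all add: dbraid_nat)
  finally show "\<epsilon> (?Y', ?X') \<cdot> (f \<odot> g) = (f \<odot> g) \<cdot> \<epsilon> (?Y, ?X)"
    by (simp add: of_anti_twist_eq)
qed simp_all

text \<open>Multiplied by \<open>\<delta> Y (X \<otimes> N)\<close>, the right-hand side loses all its double braidings and only
  \<open>\<sigma> Y\<close> conjugated by \<open>\<tau> X Y\<close> remains, which is \<open>\<sigma> Y\<close> moved past the strand \<open>X\<close>.\<close>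
lemma of_anti_twist_tensor_right:
  assumes [simp]: "X \<in> Obj B" "Y \<in> Obj B" "N \<in> Obj B"
  shows "\<epsilon> (Y, X \<otimes> N) = \<alpha> Y X N \<cdot> (inv (\<tau> Y X) \<odot> \<one> N) \<cdot> inv (\<alpha> X Y N) \<cdot> (\<one> X \<odot> \<epsilon> (Y, N)) \<cdot>
    \<alpha> X Y N \<cdot> (inv (\<tau> X Y) \<odot> \<one> N) \<cdot> inv (\<alpha> Y X N)" (is "_ = ?R")
proof -
  have "\<delta> Y (X \<otimes> N) \<cdot> ?R = \<alpha> Y X N \<cdot> (\<tau> X Y \<odot> \<one> N) \<cdot>
      (inv (\<alpha> X Y N) \<cdot> (\<one> X \<odot> (\<sigma> Y \<odot> \<one> N))) \<cdot> \<alpha> X Y N \<cdot> (inv (\<tau> X Y) \<odot> \<one> N) \<cdot> inv (\<alpha> Y X N)"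
    by (simp add: dbraid_tensor_right tensor_comp_tail of_anti_twist_eq)
  also have "inv (\<alpha> X Y N) \<cdot> (\<one> X \<odot> (\<sigma> Y \<odot> \<one> N)) = ((\<one> X \<odot> \<sigma> Y) \<odot> \<one> N) \<cdot> inv (\<alpha> X Y N)"
    by (rule assoc_inv_nat) simp_all
  also have "\<alpha> Y X N \<cdot> (\<tau> X Y \<odot> \<one> N) \<cdot> (((\<one> X \<odot> \<sigma> Y) \<odot> \<one> N) \<cdot> inv (\<alpha> X Y N)) \<cdot>
        \<alpha> X Y N \<cdot> (inv (\<tau> X Y) \<odot> \<one> N) \<cdot> inv (\<alpha> Y X N) =
      \<alpha> Y X N \<cdot> (((\<tau> X Y \<cdot> (\<one> X \<odot> \<sigma> Y)) \<cdot> inv (\<tau> X Y)) \<odot> \<one> N) \<cdot> inv (\<alpha> Y X N)"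
    by (simp add: tensor_comp_tail)
  also have "\<tau> X Y \<cdot> (\<one> X \<odot> \<sigma> Y) = (\<sigma> Y \<odot> \<one> X) \<cdot> \<tau> X Y"
    by (rule braid_nat) simp_all
  also have "\<alpha> Y X N \<cdot> ((((\<sigma> Y \<odot> \<one> X) \<cdot> \<tau> X Y) \<cdot> inv (\<tau> X Y)) \<odot> \<one> N) \<cdot> inv (\<alpha> Y X N) =
      (\<alpha> Y X N \<cdot> ((\<sigma> Y \<odot> \<one> X) \<odot> \<one> N)) \<cdot> inv (\<alpha> Y X N)"
    by simp
  also have "\<alpha> Y X N \<cdot> ((\<sigma> Y \<odot> \<one> X) \<odot> \<one> N) = (\<sigma> Y \<odot> (\<one> X \<odot> \<one> N)) \<cdot> \<alpha> Y X N"
    by (rule assoc_nat) simp_all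
  finally have *: "\<delta> Y (X \<otimes> N) \<cdot> ?R = \<sigma> Y \<odot> \<one> (X \<otimes> N)"
    by simp
  have "?R = inv (\<delta> Y (X \<otimes> N)) \<cdot> (\<delta> Y (X \<otimes> N) \<cdot> ?R)"
    by (rule inv_cancel(1)[symmetric]) simp_all
  then show ?thesis
    unfolding * by (simp add: of_anti_twist_eq)
qed

text \<open>The anti-twist equation expands \<open>\<sigma> (Y \<otimes> X)\<close> on the left. On the right \<open>\<sigma> Y\<close> moves past
  \<open>\<delta> X N\<close>. Both sides now end in \<open>\<sigma> Y \<odot> \<sigma> X \<odot> \<one> N\<close>, and what remains is the inverse of the
  full twist identity.\<close>
lemma of_anti_twist_tensor_left:
  assumes [simp]: "X \<in> Obj B" "Y \<in> Obj B" "N \<in> Obj B"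
  shows "\<epsilon> (Y \<otimes> X, N) = inv (\<alpha> Y X N) \<cdot> \<epsilon> (Y, X \<otimes> N) \<cdot> (\<one> Y \<odot> \<epsilon> (X, N)) \<cdot> \<alpha> Y X N"
proof -
  have "inv ((\<one> Y \<odot> \<delta> X N) \<cdot> \<delta> Y (X \<otimes> N)) =
      inv (\<alpha> Y X N \<cdot> (\<delta> Y X \<odot> \<one> N) \<cdot> \<delta> (Y \<otimes> X) N \<cdot> inv (\<alpha> Y X N))"
    by (simp only: full_twist assms)
  then have ft: "inv (\<delta> Y (X \<otimes> N)) \<cdot> (\<one> Y \<odot> inv (\<delta> X N)) =
      \<alpha> Y X N \<cdot> inv (\<delta> (Y \<otimes> X) N) \<cdot> (inv (\<delta> Y X) \<odot> \<one> N) \<cdot> inv (\<alpha> Y X N)"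
    by simp
  have "\<epsilon> (Y, X \<otimes> N) \<cdot> (\<one> Y \<odot> \<epsilon> (X, N)) =
      inv (\<delta> Y (X \<otimes> N)) \<cdot> (\<sigma> Y \<odot> (inv (\<delta> X N) \<cdot> (\<sigma> X \<odot> \<one> N)))"
    by (simp add: of_anti_twist_eq tensor_comp)
  also have "\<dots> = (inv (\<delta> Y (X \<otimes> N)) \<cdot> (\<one> Y \<odot> inv (\<delta> X N))) \<cdot> (\<sigma> Y \<odot> (\<sigma> X \<odot> \<one> N))"
    by (simp add: tensor_comp)
  also have "\<dots> = \<alpha> Y X N \<cdot> inv (\<delta> (Y \<otimes> X) N) \<cdot> (inv (\<delta> Y X) \<odot> \<one> N) \<cdot>
      (inv (\<alpha> Y X N) \<cdot> (\<sigma> Y \<odot> (\<sigma> X \<odot> \<one> N)))"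
    unfolding ft by simp
  also have "inv (\<alpha> Y X N) \<cdot> (\<sigma> Y \<odot> (\<sigma> X \<odot> \<one> N)) = ((\<sigma> Y \<odot> \<sigma> X) \<odot> \<one> N) \<cdot> inv (\<alpha> Y X N)"
    by (rule assoc_inv_nat) simp_all
  also have "\<alpha> Y X N \<cdot> inv (\<delta> (Y \<otimes> X) N) \<cdot> (inv (\<delta> Y X) \<odot> \<one> N) \<cdot>
      ((\<sigma> Y \<odot> \<sigma> X) \<odot> \<one> N) \<cdot> inv (\<alpha> Y X N) = \<alpha> Y X N \<cdot> \<epsilon> (Y \<otimes> X, N) \<cdot> inv (\<alpha> Y X N)"
    by (simp add: of_anti_twist_eq anti_twist_tensor tensor_comp_tail)
  finally have "(\<epsilon> (Y, X \<otimes> N) \<cdot> (\<one> Y \<odot> \<epsilon> (X, N))) \<cdot> \<alpha> Y X N =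
      (\<alpha> Y X N \<cdot> \<epsilon> (Y \<otimes> X, N) \<cdot> inv (\<alpha> Y X N)) \<cdot> \<alpha> Y X N"
    by (rule arg_cong)
  then show ?thesis
    by simp
qed

lemma braided_structure_of_anti_twist: "\<epsilon> \<in> braided_structures B (regular_module B)"
  unfolding braided_structures_def
  by (simp add: of_anti_twist_natural of_anti_twist_tensor_right of_anti_twist_tensor_left)

lemma restrict_to_unit_braided_structure_of: "restrict_to_unit B \<epsilon> = \<sigma>"
proof (rule extensionalityI[of _ "Obj B"])
  show "\<sigma> \<in> extensional (Obj B)"
    using \<sigma> by (simp add: anti_twists_def natural_automorphisms_id_iff)
  fix X assume [simp]: "X \<in> Obj B"
  have "(\<r> X \<cdot> (\<sigma> X \<odot> \<one> \<I>)) \<cdot> inv (\<r> X) = \<sigma> X"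
    using runit_nat[of "\<sigma> X"] by simp
  then show "restrict_to_unit B \<epsilon> X = \<sigma> X"
    by (simp add: restrict_to_unit_def of_anti_twist_eq dbraid_unit)
qed (simp add: restrict_to_unit_def)

end

context
  fixes E
  assumes E: "E \<in> braided_structures B (regular_module B)"
begin

abbreviation \<theta> where "\<theta> \<equiv> restrict_to_unit B E"

lemma braided_structure_natural: "E \<in> natural_automorphisms (B \<times>\<^sub>c B) B (tensor B)"
  using E by (simp add: braided_structures_def)

lemma braided_structure_simps [simp]:
  assumes "Y \<in> Obj B" "X \<in> Obj B"
  shows "is_iso B (E (Y, X))" "E (Y, X) \<in> Arr B" "Dom B (E (Y, X)) = Y \<otimes> X" "Cod B (E (Y, X)) = Y \<otimes> X"
  using braided_structure_natural assms iso_arr by (auto simp: natural_automorphisms_tensor_iff)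

lemma braided_structure_nat:
  assumes "f \<in> Arr B" "g \<in> Arr B" "Dom B f = Y" "Dom B g = X" "Cod B f = Y'" "Cod B g = X'"
  shows "E (Y', X') \<cdot> (f \<odot> g) = (f \<odot> g) \<cdot> E (Y, X)"
  using braided_structure_natural assms by (auto simp: natural_automorphisms_tensor_iff)

lemma restriction_eq: "X \<in> Obj B \<Longrightarrow> \<theta> X = \<r> X \<cdot> E (X, \<I>) \<cdot> inv (\<r> X)"
  by (simp add: restrict_to_unit_def)

lemma restriction_simps [simp]:
  assumes "X \<in> Obj B"
  shows "is_iso B (\<theta> X)" "\<theta> X \<in> Arr B" "Dom B (\<theta> X) = X" "Cod B (\<theta> X) = X"
  using assms by (simp_all add: restriction_eq)

lemma restriction_runit: "X \<in> Obj B \<Longrightarrow> \<theta> X \<cdot> \<r> X = \<r> X \<cdot> E (X, \<I>)"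
  by (simp add: restriction_eq)

lemma restriction_natural: "\<theta> \<in> natural_automorphisms B B id_functor"
  unfolding natural_automorphisms_id_iff
proof (intro conjI ballI)
  show "\<theta> \<in> extensional (Obj B)"
    by (simp add: restrict_to_unit_def)
  fix f assume [simp]: "f \<in> Arr B"
  let ?X = "Dom B f" and ?Y = "Cod B f"
  have "(\<theta> ?Y \<cdot> f) \<cdot> \<r> ?X = \<theta> ?Y \<cdot> (f \<cdot> \<r> ?X)"
    by simp
  also have "\<dots> = (\<theta> ?Y \<cdot> \<r> ?Y) \<cdot> (f \<odot> \<one> \<I>)"
    by (simp flip: runit_nat)
  also have "\<dots> = \<r> ?Y \<cdot> (E (?Y, \<I>) \<cdot> (f \<odot> \<one> \<I>))"
    by (simp add: restriction_runit)
  also have "\<dots> = (\<r> ?Y \<cdot> (f \<odot> \<one> \<I>)) \<cdot> E (?X, \<I>)"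
    by (subst braided_structure_nat[where Y = ?X and X = \<I>]) simp_all
  also have "\<dots> = f \<cdot> (\<r> ?X \<cdot> E (?X, \<I>))"
    by (simp add: runit_nat)
  also have "\<dots> = (f \<cdot> \<theta> ?X) \<cdot> \<r> ?X"
    by (simp flip: restriction_runit)
  finally show "\<theta> ?Y \<cdot> f = f \<cdot> \<theta> ?X"
    by (rule iso_right_cancel[rotated -1]) simp_all
qed simp_all

text \<open>Naturality along \<open>\<r> X\<close> replaces \<open>E(Y, X)\<close> by \<open>E(Y, X \<otimes> \<I>)\<close>, to which the first axiom applies
  with \<open>N = \<I>\<close>. The unitor is then moved from left to right through the composite; it absorbs all
  associators on its way and turns \<open>E(Y, \<I>)\<close> into its restriction.\<close>
lemma determined_by_restriction:
  assumes [simp]: "Y \<in> Obj B" "X \<in> Obj B"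
  shows "E (Y, X) = inv (\<delta> Y X) \<cdot> (\<theta> Y \<odot> \<one> X)"
proof -
  have r: "\<r> (V \<otimes> W) \<cdot> (inv (\<tau> V W) \<odot> \<one> \<I>) = inv (\<tau> V W) \<cdot> \<r> (W \<otimes> V)"
    if [simp]: "V \<in> Obj B" "W \<in> Obj B" for V W
    using runit_nat[of "inv (\<tau> V W)"] by simp
  have "E (Y, X) \<cdot> (\<one> Y \<odot> \<r> X) = (\<one> Y \<odot> \<r> X) \<cdot> E (Y, X \<otimes> \<I>)"
    by (rule braided_structure_nat) simp_all
  also have "E (Y, X \<otimes> \<I>) = \<alpha> Y X \<I> \<cdot> (inv (\<tau> Y X) \<odot> \<one> \<I>) \<cdot> inv (\<alpha> X Y \<I>) \<cdot>
      (\<one> X \<odot> E (Y, \<I>)) \<cdot> \<alpha> X Y \<I> \<cdot> (inv (\<tau> X Y) \<odot> \<one> \<I>) \<cdot> inv (\<alpha> Y X \<I>)"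
    using E by (simp add: braided_structures_def)
  also have "(\<one> Y \<odot> \<r> X) \<cdot> \<dots> = (\<r> (Y \<otimes> X) \<cdot> (inv (\<tau> Y X) \<odot> \<one> \<I>)) \<cdot> inv (\<alpha> X Y \<I>) \<cdot>
      (\<one> X \<odot> E (Y, \<I>)) \<cdot> \<alpha> X Y \<I> \<cdot> (inv (\<tau> X Y) \<odot> \<one> \<I>) \<cdot> inv (\<alpha> Y X \<I>)"
    by (simp add: runit_tensor)
  also have "\<dots> = inv (\<tau> Y X) \<cdot> (\<r> (X \<otimes> Y) \<cdot> inv (\<alpha> X Y \<I>)) \<cdot>
      (\<one> X \<odot> E (Y, \<I>)) \<cdot> \<alpha> X Y \<I> \<cdot> (inv (\<tau> X Y) \<odot> \<one> \<I>) \<cdot> inv (\<alpha> Y X \<I>)"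
    by (subst r) simp_all
  also have "\<dots> = inv (\<tau> Y X) \<cdot> (\<one> X \<odot> (\<r> Y \<cdot> E (Y, \<I>))) \<cdot>
      \<alpha> X Y \<I> \<cdot> (inv (\<tau> X Y) \<odot> \<one> \<I>) \<cdot> inv (\<alpha> Y X \<I>)"
    by (subst runit_tensor_inv) (simp_all add: tensor_comp_tail)
  also have "\<dots> = inv (\<tau> Y X) \<cdot> (\<one> X \<odot> \<theta> Y) \<cdot> ((\<one> X \<odot> \<r> Y) \<cdot> \<alpha> X Y \<I>) \<cdot>
      (inv (\<tau> X Y) \<odot> \<one> \<I>) \<cdot> inv (\<alpha> Y X \<I>)"
    by (simp add: tensor_comp_tail restriction_runit)
  also have "\<dots> = inv (\<tau> Y X) \<cdot> (\<one> X \<odot> \<theta> Y) \<cdot> (\<r> (X \<otimes> Y) \<cdot> (inv (\<tau> X Y) \<odot> \<one> \<I>)) \<cdot>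
      inv (\<alpha> Y X \<I>)"
    by (simp add: runit_tensor)
  also have "\<dots> = inv (\<tau> Y X) \<cdot> (\<one> X \<odot> \<theta> Y) \<cdot> inv (\<tau> X Y) \<cdot> (\<r> (Y \<otimes> X) \<cdot> inv (\<alpha> Y X \<I>))"
    by (subst r) simp_all
  also have "\<dots> = (inv (\<tau> Y X) \<cdot> ((\<one> X \<odot> \<theta> Y) \<cdot> inv (\<tau> X Y))) \<cdot> (\<one> Y \<odot> \<r> X)"
    by (subst runit_tensor_inv) simp_all
  also have "(\<one> X \<odot> \<theta> Y) \<cdot> inv (\<tau> X Y) = inv (\<tau> X Y) \<cdot> (\<theta> Y \<odot> \<one> X)"
    by (rule inv_square[symmetric]) (simp_all add: braid_nat)
  also have "inv (\<tau> Y X) \<cdot> (inv (\<tau> X Y) \<cdot> (\<theta> Y \<odot> \<one> X)) = inv (\<delta> Y X) \<cdot> (\<theta> Y \<odot> \<one> X)"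
    by (simp add: dbraid_eq)
  finally show ?thesis
    by (rule iso_right_cancel[rotated -1]) simp_all
qed

lemma braided_structure_of_restriction: "braided_structure_of B \<theta> = E"
proof (rule extensionalityI[of _ "Obj B \<times> Obj B"])
  show "E \<in> extensional (Obj B \<times> Obj B)"
    using braided_structure_natural by (simp add: natural_automorphisms_tensor_iff)
qed (auto simp: braided_structure_of_def determined_by_restriction)

text \<open>The second axiom at \<open>N = \<I>\<close>, after naturality along \<open>\<r> X\<close> has replaced \<open>E(Y, X \<otimes> \<I>)\<close>
  by \<open>E(Y, X)\<close>.\<close>
lemma restriction_tensor:
  assumes [simp]: "Y \<in> Obj B" "X \<in> Obj B"
  shows "\<theta> (Y \<otimes> X) = inv (\<delta> Y X) \<cdot> (\<theta> Y \<odot> \<theta> X)"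
proof -
  have "\<theta> (Y \<otimes> X) \<cdot> \<r> (Y \<otimes> X) = \<r> (Y \<otimes> X) \<cdot> E (Y \<otimes> X, \<I>)"
    by (simp add: restriction_runit)
  also have "E (Y \<otimes> X, \<I>) =
      inv (\<alpha> Y X \<I>) \<cdot> E (Y, X \<otimes> \<I>) \<cdot> (\<one> Y \<odot> E (X, \<I>)) \<cdot> \<alpha> Y X \<I>"
    using E unfolding braided_structures_def by simp
  also have "\<r> (Y \<otimes> X) \<cdot> \<dots> =
      ((\<one> Y \<odot> \<r> X) \<cdot> E (Y, X \<otimes> \<I>)) \<cdot> (\<one> Y \<odot> E (X, \<I>)) \<cdot> \<alpha> Y X \<I>"
    by (simp add: runit_tensor)
  also have "(\<one> Y \<odot> \<r> X) \<cdot> E (Y, X \<otimes> \<I>) = E (Y, X) \<cdot> (\<one> Y \<odot> \<r> X)"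
    by (rule braided_structure_nat[symmetric]) simp_all
  also have "(E (Y, X) \<cdot> (\<one> Y \<odot> \<r> X)) \<cdot> (\<one> Y \<odot> E (X, \<I>)) \<cdot> \<alpha> Y X \<I> =
      (E (Y, X) \<cdot> (\<one> Y \<odot> \<theta> X)) \<cdot> \<r> (Y \<otimes> X)"
    by (simp add: tensor_comp_tail restriction_runit runit_tensor)
  finally have "\<theta> (Y \<otimes> X) = E (Y, X) \<cdot> (\<one> Y \<odot> \<theta> X)"
    by (rule iso_right_cancel[rotated -1]) simp_all
  also have "\<dots> = inv (\<delta> Y X) \<cdot> (\<theta> Y \<odot> \<theta> X)"
    by (simp add: determined_by_restriction tensor_comp)
  finally show ?thesis .
qed

lemma restriction_anti_twist: "\<theta> \<in> anti_twists B"
  by (simp add: anti_twists_def restriction_natural restriction_tensor)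

end

lemma bij_betw_restrict_to_unit:
  "bij_betw (restrict_to_unit B) (braided_structures B (regular_module B)) (anti_twists B)"
  by (rule bij_betw_byWitness[where f' = "braided_structure_of B"])
    (auto simp: braided_structure_of_restriction restrict_to_unit_braided_structure_of
      braided_structure_of_anti_twist restriction_anti_twist)

end

theorem lemma3p18:
  fixes B :: "('o, 'a, 'z) braided_category_scheme"
  assumes "rigid_braided_category B"
  shows "bij_betw (restrict_to_unit B) (braided_structures B (regular_module B)) (anti_twists B)"
proof -
  interpret rigid_braided_category B by fact
  show ?thesis by (rule bij_betw_restrict_to_unit)
qed

end
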